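(* For every positive integer $k$, let $n = 5k-2\lceil\sqrt{2k-1}\rceil-3$. Then there exists a 2-edge-coloring (red/blue) of the complete graph $K_n$ such that there is no $k$-connected monochromatic subgraph containing at least $n-2k+2$ vertices.
   Context: A graph is $k$-connected if it has more than $k$ vertices and has no vertex cut of size at most $k-1$. A monochromatic subgraph is a subgraph all of whose edges have the same color. *)

theory Defs
  imports Complex_Main "HOL-Library.Ramsey"
begin

text \<open>A graph is given by its vertex set and its set of edges, an edge being a two-element set of
  vertices.\<close>

definition simple_graph :: "'a set \<Rightarrow> 'a set set \<Rightarrow> bool" where
  "simple_graph V E \<longleftrightarrow> finite V \<and> E \<subseteq> nsets V 2"

definition subgraph :: "'a set \<Rightarrow> 'a set set \<Rightarrow> 'a set \<Rightarrow> 'a set set \<Rightarrow> bool" where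
  "subgraph W F V E \<longleftrightarrow> simple_graph W F \<and> W \<subseteq> V \<and> F \<subseteq> E"

definition graph_connected :: "'a set \<Rightarrow> 'a set set \<Rightarrow> bool" where
  "graph_connected V E \<longleftrightarrow> (\<forall>u\<in>V. \<forall>v\<in>V. (u, v) \<in> {(x, y). {x, y} \<in> E}\<^sup>*)"

definition delete_vertices_edges :: "'a set set \<Rightarrow> 'a set \<Rightarrow> 'a set set" where
  "delete_vertices_edges E S = {e \<in> E. e \<inter> S = {}}"

definition vertex_cut :: "'a set \<Rightarrow> 'a set set \<Rightarrow> 'a set \<Rightarrow> bool" where
  "vertex_cut V E S \<longleftrightarrow>
     S \<subseteq> V \<and> \<not> graph_connected (V - S) (delete_vertices_edges E S)"

text \<open>For natural numbers, \<open>card S < k\<close> expresses that the size of \<open>S\<close> is at most \<open>k - 1\<close> while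
  avoiding truncated subtraction.\<close>

definition k_connected :: "nat \<Rightarrow> 'a set \<Rightarrow> 'a set set \<Rightarrow> bool" where
  "k_connected k V E \<longleftrightarrow> card V > k \<and> \<not> (\<exists>S. vertex_cut V E S \<and> card S < k)"

datatype colour = Red | Blue

definition monochromatic_edges :: "('a set \<Rightarrow> colour) \<Rightarrow> 'a set set \<Rightarrow> bool" where
  "monochromatic_edges c F \<longleftrightarrow> (\<exists>i. \<forall>e\<in>F. c e = i)"

text \<open>The integer expression defining the number of vertices is never negative, so
  it always denotes a natural number.\<close>

lemma order_nonneg:
  fixes k :: nat
  assumes "k > 0"
  shows "0 \<le> 5 * int k - 2 * \<lceil>sqrt (2 * real k - 1)\<rceil> - 3"
proof -
  have "2 * real k - 1 \<le> (real k)\<^sup>2"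
    using zero_le_power2[of "real k - 1"] by (simp add: power2_diff)
  then have "sqrt (2 * real k - 1) \<le> real k"
    by (simp add: real_le_lsqrt)
  then have "\<lceil>sqrt (2 * real k - 1)\<rceil> \<le> int k"
    by (simp add: ceiling_le_iff)
  then show ?thesis
    using assms by linarith
qed

end

theory Submission
  imports Defs
begin

text \<open>
  Put \<open>m = k - 1\<close> and \<open>s = \<lceil>sqrt (2 m + 1)\<rceil>\<close>, so that \<open>n = 5 m + 2 - 2 s\<close>. It suffices that each
  colour class loses more than \<open>2 m\<close> vertices by repeatedly discarding a vertex of degree at most
  \<open>m\<close>, or the small side of a cut of size at most \<open>m\<close>.

  If \<open>n > 4 m\<close>, split the vertices into \<open>P\<close>, \<open>X\<close>, \<open>A\<close>, \<open>B\<close>, \<open>Q\<close>, \<open>Y\<close> of sizes \<open>m\<close>, \<open>s\<close>, \<open>m + 1 - s\<close>,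
  \<open>m + 1\<close>, \<open>m - s\<close>, \<open>m - s\<close>. The pairs \<open>A\<close>-\<open>X\<close>, \<open>A\<close>-\<open>Q\<close>, \<open>X\<close>-\<open>Y\<close>, \<open>Q\<close>-\<open>Y\<close>, \<open>B\<close>-\<open>Y\<close>, \<open>B\<close>-\<open>Q\<close> and
  \<open>B\<close>-\<open>B\<close> are red; between \<open>P \<union> X\<close> and \<open>B\<close> the blue edges form a bipartite graph \<open>H\<close>; all other pairs
  are blue. If every \<open>p \<in> P\<close> has at least one and every \<open>x \<in> X\<close> at least \<open>m + 1 - s\<close> neighbours in
  \<open>H\<close>, then \<open>P\<close>, \<open>A\<close> and then \<open>X\<close> are discarded in red. If every \<open>b \<in> B\<close> has at most \<open>s - 1\<close>
  neighbours in \<open>H\<close>, then \<open>B\<close> is discarded in blue, and then \<open>X \<union> Q\<close>, which \<open>P\<close> separates from the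
  rest (as \<open>n > 4 m\<close>, the \<open>2 m\<close> vertices of \<open>P \<union> X \<union> Q\<close> are too few to matter). Both times \<open>2 m + 1\<close> vertices are lost. Such an \<open>H\<close> exists as soon as
  \<open>m + s (m + 1 - s) \<le> (s - 1) (m + 1)\<close>, that is, \<open>2 m + 1 \<le> s\<^sup>2\<close>.

  If \<open>n \<le> 4 m\<close>, blow up the self-complementary path on four vertices into blocks of size at most \<open>m\<close>.
\<close>

section \<open>Separations and low degrees in k-connected graphs\<close>

text \<open>Otherwise \<open>S \<inter> W\<close> would be a vertex cut: once it is deleted, walks
  that start in \<open>A\<close> stay in \<open>A - S\<close>.\<close>

lemma k_connected_separation:
  assumes conn: "k_connected k W F" and graph: "simple_graph W F" and "finite S" "card S < k"
    and closed: "\<And>x y. x \<in> A \<Longrightarrow> {x, y} \<in> F \<Longrightarrow> y \<in> A \<union> S"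
  shows "W \<inter> A \<subseteq> S \<or> W \<subseteq> A \<union> S"
proof (rule ccontr)
  assume "\<not> ?thesis"
  then obtain u v where u: "u \<in> W" "u \<in> A" "u \<notin> S" and v: "v \<in> W" "v \<notin> A" "v \<notin> S"
    by blast
  let ?E = "delete_vertices_edges F (S \<inter> W)"
  have "card (S \<inter> W) < k"
    using \<open>finite S\<close> \<open>card S < k\<close> by (meson card_mono inf_le1 le_less_trans)
  then have "\<not> vertex_cut W F (S \<inter> W)"
    using conn by (auto simp: k_connected_def)
  then have "graph_connected (W - S \<inter> W) ?E"
    by (simp add: vertex_cut_def)
  then have "(u, v) \<in> {(x, y). {x, y} \<in> ?E}\<^sup>*"
    using u v by (auto simp: graph_connected_def)
  then have "v \<in> A - S"
  proof (induction rule: rtrancl_induct)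
    case base
    then show ?case using u by simp
  next
    case (step y z)
    then have "{y, z} \<in> F" "{y, z} \<inter> (S \<inter> W) = {}"
      by (auto simp: delete_vertices_edges_def)
    moreover from this have "{y, z} \<subseteq> W"
      using graph by (auto simp: simple_graph_def nsets_def)
    ultimately show ?case
      using closed[of y z] step.IH by blast
  qed
  then show False
    using v by blast
qed

text \<open>Separating \<open>{w}\<close> from the rest would put \<open>W\<close> inside
  \<open>insert w S\<close>, which has at most \<open>k\<close> elements.\<close>

lemma k_connected_min_degree:
  assumes conn: "k_connected k W F" and graph: "simple_graph W F" and "finite S" "card S < k"
    and nbrs: "\<And>y. {w, y} \<in> F \<Longrightarrow> y \<in> S"
  shows "w \<notin> W"
proof
  assume "w \<in> W"
  have "card W > k"
    using conn by (simp add: k_connected_def)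
  have "{w, w} \<notin> F"
    using graph by (auto simp: simple_graph_def nsets_def)
  \<comment> \<open>Taking \<open>w\<close> out of \<open>S\<close> makes the first alternative
    impossible.\<close>
  then have "W \<inter> {w} \<subseteq> S - {w} \<or> W \<subseteq> {w} \<union> (S - {w})"
    using nbrs \<open>finite S\<close> \<open>card S < k\<close>
    by (intro k_connected_separation[OF conn graph])
      (auto intro: le_less_trans[OF card_Diff1_le])
  then have "W \<subseteq> insert w S"
    using \<open>w \<in> W\<close> by blast
  then have "card W \<le> card (insert w S)"
    using \<open>finite S\<close> by (simp add: card_mono)
  also have "\<dots> \<le> Suc (card S)"
    using \<open>finite S\<close> by (simp add: card_insert_if)
  finally show False
    using \<open>card W > k\<close> \<open>card S < k\<close> by linarith
qed

section \<open>Blow-ups of the path on four vertices, for n \<le> 4 m\<close>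

text \<open>Class 1 cuts off class 0 and class 2 cuts off class 3, so \<open>W\<close> lies in an
  end pair of classes or both end classes are empty. Either way a middle class sees a single class,
  of fewer than \<open>k\<close> vertices, and the degree bound empties it.\<close>

lemma not_k_connected_path_blowup:
  fixes f :: "'a \<Rightarrow> nat"
  assumes graph: "simple_graph W F"
    and range: "\<And>x. x \<in> W \<Longrightarrow> f x < 4"
    and card: "\<And>i. card {x \<in> W. f x = i} < k"
    and edges: "\<And>x y. {x, y} \<in> F \<Longrightarrow>
      (f x, f y) \<in> {(0,0), (0,1), (1,0), (1,2), (2,1), (2,3), (3,2), (3,3)}"
  shows "\<not> k_connected k W F"
proof
  assume conn: "k_connected k W F"
  define C where "C i = {x \<in> W. f x = i}" for i
  have "finite W"
    using graph by (simp add: simple_graph_def)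
  then have fin: "finite (C i)" for i
    by (simp add: C_def)
  have card_C: "card (C i) < k" for i
    using card by (simp add: C_def)
  have not_sub: "\<not> W \<subseteq> C i" for i
    using conn card_mono[OF fin, of W i] card_C[of i] by (auto simp: k_connected_def)
  have edge: "x \<in> W \<and> y \<in> W" if "{x, y} \<in> F" for x y
    using graph that by (auto simp: simple_graph_def nsets_def)
  have W: "x \<in> C 0 \<or> x \<in> C 1 \<or> x \<in> C 2 \<or> x \<in> C 3" if "x \<in> W" for x
    using range[OF that] that by (auto simp: C_def)
  have "W \<inter> C 0 \<subseteq> C 1 \<or> W \<subseteq> C 0 \<union> C 1"
    by (rule k_connected_separation[OF conn graph fin card_C])
      (use edges edge in \<open>fastforce simp: C_def\<close>)
  then have sep0: "C 0 = {} \<or> W \<subseteq> C 0 \<union> C 1"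
    by (auto simp: C_def)
  have "W \<inter> C 3 \<subseteq> C 2 \<or> W \<subseteq> C 3 \<union> C 2"
    by (rule k_connected_separation[OF conn graph fin card_C])
      (use edges edge in \<open>fastforce simp: C_def\<close>)
  then have sep3: "C 3 = {} \<or> W \<subseteq> C 3 \<union> C 2"
    by (auto simp: C_def)
  have no_mid: "C i = {}"
    if ij: "(i, j, l) \<in> {(1, 0, 2), (1, 2, 0), (2, 1, 3), (2, 3, 1)}" and "C j = {}" for i j l :: nat
  proof -
    have "x \<notin> W" if "x \<in> C i" for x
    proof (rule k_connected_min_degree[OF conn graph fin card_C])
      fix y assume "{x, y} \<in> F"
      then have "y \<in> C j \<union> C l"
        using edges[of x y] edge[of x y] ij \<open>x \<in> C i\<close> by (auto simp: C_def)
      then show "y \<in> C l"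
        using \<open>C j = {}\<close> by simp
    qed
    then show ?thesis
      by (auto simp: C_def)
  qed
  consider "W \<subseteq> C 0 \<union> C 1" | "W \<subseteq> C 3 \<union> C 2" | "C 0 = {}" "C 3 = {}"
    using sep0 sep3 by blast
  then show False
  proof cases
    case 1
    then have "C 2 = {}"
      by (auto simp: C_def)
    then have "C 1 = {}"
      by (intro no_mid[of 1 2 0]) auto
    then show False
      using 1 not_sub by auto
  next
    case 2
    then have "C 1 = {}"
      by (auto simp: C_def)
    then have "C 2 = {}"
      by (intro no_mid[of 2 1 3]) auto
    then show False
      using 2 not_sub by auto
  next
    case 3
    then have "C 1 = {}" "C 2 = {}"
      using no_mid[of 1 0 2] no_mid[of 2 3 1] by simp_all
    then have "W = {}"
      using 3 W by blast
    then show False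
      using not_sub by blast
  qed
qed

lemma path_blowup_colouring:
  assumes "n \<le> 4 * m"
  shows "\<exists>c :: nat set \<Rightarrow> colour.
    \<forall>W F. subgraph W F {..<n} (nsets {..<n} 2) \<longrightarrow> monochromatic_edges c F \<longrightarrow>
      \<not> k_connected (Suc m) W F"
proof -
  define f where "f x = x div m" for x :: nat
  \<comment> \<open>The complement of the path 0-1-2-3 is the path 2-0-3-1; this permutation carries
    it, with the loops at its ends, to 0-1-2-3.\<close>
  define g :: "nat \<Rightarrow> nat" where "g x = [1, 3, 0, 2] ! f x" for x
  define red where "red x y \<longleftrightarrow> (f x, f y) \<in> {(0,0), (0,1), (1,0), (1,2), (2,1), (2,3), (3,2), (3,3)}"
    for x y
  define c where "c e = (if \<exists>x y. e = {x, y} \<and> red x y then Red else Blue)" for e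
  have red_sym: "red x y \<longleftrightarrow> red y x" for x y
    by (auto simp: red_def)
  have c_Red: "c {x, y} = Red \<longleftrightarrow> red x y" for x y
    by (auto simp: c_def doubleton_eq_iff red_sym)
  have f_less: "f x < 4" if "x < n" for x
    using that assms unfolding f_def by (simp add: less_mult_imp_div_less)
  have g_less: "g x < 4" if "x < n" for x
    using f_less[OF that] by (auto simp: g_def less_Suc_eq numeral_eq_Suc)
  have card_f: "card {x \<in> W. f x = i} < Suc m" if "W \<subseteq> {..<n}" for W i
  proof -
    \<comment> \<open>For \<open>m = 0\<close> every quotient by \<open>m\<close> is 0, but then
      there are no vertices.\<close>
    have "m > 0 \<or> n = 0" using assms by auto
    then have "{x \<in> W. f x = i} \<subseteq> {i * m..<i * m + m}"
      using that dividend_less_div_times[of m] by (auto simp: f_def add.commute)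
    then have "card {x \<in> W. f x = i} \<le> card {i * m..<i * m + m}"
      by (intro card_mono) auto
    then show ?thesis by simp
  qed
  have g_preimage: "\<exists>j. {x \<in> W. g x = i} \<subseteq> {x \<in> W. f x = j}" if "W \<subseteq> {..<n}" for W i
  proof -
    have "g x = i \<Longrightarrow> f x = (if i = 0 then 2 else if i = 1 then 0 else if i = 2 then 3 else 1)"
      if "x \<in> W" for x
      using f_less[of x] that \<open>W \<subseteq> {..<n}\<close>
      by (fastforce simp: g_def less_Suc_eq numeral_eq_Suc)
    then show ?thesis by blast
  qed
  have "\<not> k_connected (Suc m) W F"
    if sub: "subgraph W F {..<n} (nsets {..<n} 2)" and mono: "monochromatic_edges c F" for W F
  proof -
    have graph: "simple_graph W F" and W: "W \<subseteq> {..<n}"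
      using sub by (auto simp: subgraph_def)
    have edge: "x < n \<and> y < n" if "{x, y} \<in> F" for x y
      using graph W that by (auto simp: simple_graph_def nsets_def)
    obtain i where i: "\<And>e. e \<in> F \<Longrightarrow> c e = i"
      using mono by (auto simp: monochromatic_edges_def)
    show ?thesis
    proof (cases i)
      case Red
      show ?thesis
      proof (rule not_k_connected_path_blowup[OF graph, where f = f])
        show "(f x, f y) \<in> {(0,0), (0,1), (1,0), (1,2), (2,1), (2,3), (3,2), (3,3)}"
          if "{x, y} \<in> F" for x y
          using i[OF that] Red c_Red[of x y] by (simp add: red_def)
      qed (use W f_less card_f in auto)
    next
      case Blue
      show ?thesis
      proof (rule not_k_connected_path_blowup[OF graph, where f = g])
        show "(g x, g y) \<in> {(0,0), (0,1), (1,0), (1,2), (2,1), (2,3), (3,2), (3,3)}"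
          if "{x, y} \<in> F" for x y
        proof -
          have nred: "\<not> red x y"
            using i[OF that] Blue c_Red[of x y] by auto
          have less: "f x < 4" "f y < 4"
            using f_less edge[OF that] by auto
          have "\<forall>a<4. \<forall>b<4.
              (a, b) \<notin> {(0,0), (0,1), (1,0), (1,2), (2,1), (2,3), (3,2), (3,3)} \<longrightarrow>
              ([1, 3, 0, 2] ! a, [1, 3, 0, 2] ! b) \<in>
                {(0,0), (0,1), (1,0), (1,2), (2,1), (2,3), (3,2), (3::nat,3::nat)}"
            by (simp add: numeral_eq_Suc All_less_Suc)
          from this[rule_format, OF less nred[unfolded red_def]] show ?thesis
            unfolding g_def .
        qed
        show "card {x \<in> W. g x = j} < Suc m" for j
        proof -
          obtain j' where "{x \<in> W. g x = j} \<subseteq> {x \<in> W. f x = j'}"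
            using g_preimage[OF W] by blast
          then have "card {x \<in> W. g x = j} \<le> card {x \<in> W. f x = j'}"
            using graph by (intro card_mono) (auto simp: simple_graph_def)
          then show ?thesis
            using card_f[OF W, of j'] by simp
        qed
      qed (use W g_less in auto)
    qed
  qed
  then show ?thesis by blast
qed

section \<open>The six-block colouring, for n > 4 m\<close>

lemma bipartite_graph_with_demands:
  fixes m s :: nat
  assumes "s \<le> m" and "2 * m + 1 \<le> s\<^sup>2"
  obtains H :: "nat \<Rightarrow> nat \<Rightarrow> bool" where
    "\<And>b. finite {u. H u b}" "\<And>b. card {u. H u b} < s"
    "\<And>u. u < m \<Longrightarrow> \<exists>b\<le>m. H u b"
    "\<And>u. m \<le> u \<Longrightarrow> u < m + s \<Longrightarrow> m + 1 - s \<le> card {b. b \<le> m \<and> H u b}"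
proof -
  define d where "d = m + 1 - s"
  define T where "T = m + s * d"
  \<comment> \<open>Vertices hand out consecutive slots, one per unit of demand, which are dealt cyclically to
    the \<open>m + 1\<close> vertices on the other side.\<close>
  define own where "own p = (if p < m then p else m + (p - m) div d)" for p
  define H where "H u b \<longleftrightarrow> (\<exists>p<T. own p = u \<and> p mod (m + 1) = b)" for u b
  have "d > 0"
    using assms by (simp add: d_def)
  have "s > 0"
    using assms by (cases s) auto
  \<comment> \<open>This turns the truncated differences in the bound on \<open>T\<close> into
    sums.\<close>
  obtain r e where re: "s = Suc r" "m = Suc r + e"
    using \<open>s > 0\<close> \<open>s \<le> m\<close> by (metis Suc_pred le_iff_add)
  have T: "T \<le> (s - 1) * (m + 1)"
    using assms(2) by (simp add: T_def d_def re power2_eq_square algebra_simps)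
  have H_own: "{u. H u b} = own ` {p. p < T \<and> p mod (m + 1) = b}" for b
    by (auto simp: H_def)
  have "card {u. H u b} < s" for b
  proof -
    \<comment> \<open>A slot is determined by its receiver \<open>b\<close> and its round
      \<open>p div (m + 1)\<close>; by the bound on \<open>T\<close> there are at most
      \<open>s - 1\<close> rounds.\<close>
    have "{p. p < T \<and> p mod (m + 1) = b} \<subseteq> (\<lambda>q. q * (m + 1) + b) ` {..<s - 1}"
    proof
      fix p assume p: "p \<in> {p. p < T \<and> p mod (m + 1) = b}"
      then have "p = p div (m + 1) * (m + 1) + b"
        by (metis (mono_tags) div_mult_mod_eq mem_Collect_eq)
      moreover have "p div (m + 1) < s - 1"
        using p T by (intro less_mult_imp_div_less) simp
      ultimately show "p \<in> (\<lambda>q. q * (m + 1) + b) ` {..<s - 1}"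
        by blast
    qed
    then have "card {u. H u b} \<le> card {..<s - 1}"
      unfolding H_own by (meson card_image_le card_mono finite_imageI finite_lessThan le_trans
          finite_subset)
    then show ?thesis
      using \<open>s > 0\<close> by simp
  qed
  moreover have "finite {u. H u b}" for b
    unfolding H_own by simp
  moreover have "\<exists>b\<le>m. H u b" if "u < m" for u
    using that by (intro exI[of _ u]) (auto simp: H_def own_def T_def intro!: exI[of _ u])
  moreover have "m + 1 - s \<le> card {b. b \<le> m \<and> H u b}" if "m \<le> u" "u < m + s" for u
  proof -
    define j where "j = u - m"
    have "j < s" and u: "u = m + j"
      using that by (auto simp: j_def)
    \<comment> \<open>The slots owned by \<open>u\<close>: as d \<le> m, they go to distinct
      receivers.\<close>
    let ?I = "{m + j * d..<m + j * d + d}"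
    have "x = y" if "x \<in> ?I" "y \<in> ?I" "x mod (m + 1) = y mod (m + 1)" "x \<le> y" for x y
    proof -
      have "m + 1 dvd y - x"
        using that by (metis mod_eq_dvd_iff_nat)
      moreover have "y - x < m + 1"
        using that \<open>s > 0\<close> by (auto simp: d_def)
      ultimately show "x = y"
        using \<open>x \<le> y\<close> by (metis diff_is_0_eq dvd_imp_le le_antisym linorder_not_less neq0_conv)
    qed
    then have "inj_on (\<lambda>p. p mod (m + 1)) ?I"
      unfolding inj_on_def by (metis nat_le_linear)
    then have "card ((\<lambda>p. p mod (m + 1)) ` ?I) = d"
      by (simp add: card_image)
    moreover have "(\<lambda>p. p mod (m + 1)) ` ?I \<subseteq> {b. b \<le> m \<and> H u b}"
    proof (clarify, intro conjI)
      fix p assume p: "p \<in> ?I"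
      show "p mod (m + 1) \<le> m"
        by (simp add: less_Suc_eq_le[symmetric])
      have "(j + 1) * d \<le> s * d"
        using \<open>j < s\<close> by (intro mult_right_mono) auto
      then have "p < T"
        using p by (simp add: T_def)
      moreover have "(p - m) div d = j"
        using p by (intro div_nat_eqI) (auto simp: algebra_simps)
      then have "own p = u"
        using p by (simp add: own_def u)
      ultimately show "H u (p mod (m + 1))"
        by (auto simp: H_def)
    qed
    moreover have "finite {b. b \<le> m \<and> H u b}"
      by simp
    ultimately show ?thesis
      by (metis card_mono d_def)
  qed
  ultimately show thesis
    using that by blast
qed

text \<open>Given \<open>n\<close>, the bound \<open>2 * s \<le> m + 1\<close> says n > 4 m. The
  conclusion is |W| < n - 2 k + 2 for k = m + 1, free of subtraction.\<close>

lemma six_block_colouring: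
  fixes m s :: nat
  assumes "2 * s \<le> m + 1" and square: "2 * m + 1 \<le> s\<^sup>2" and n: "n = 5 * m + 2 - 2 * s"
  shows "\<exists>c :: nat set \<Rightarrow> colour.
    \<forall>W F. subgraph W F {..<n} (nsets {..<n} 2) \<longrightarrow> monochromatic_edges c F \<longrightarrow>
      k_connected (Suc m) W F \<longrightarrow> card W + 2 * m < n"
proof -
  have "s > 0"
    using square by (cases s) auto
  then have "s \<le> m"
    using assms(1) by linarith
  obtain H where H: "\<And>b. finite {u. H u b}" "\<And>b. card {u. H u b} < s"
    "\<And>u. u < m \<Longrightarrow> \<exists>b\<le>m. H u b"
    "\<And>u. m \<le> u \<Longrightarrow> u < m + s \<Longrightarrow> m + 1 - s \<le> card {b. b \<le> m \<and> H u b}"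
    using bipartite_graph_with_demands[OF \<open>s \<le> m\<close> square] by blast
  \<comment> \<open>Consecutive intervals: \<open>P \<union> X\<close> matches the left side of
    \<open>H\<close> directly, while the right side is shifted by \<open>m + s\<close> to become
    \<open>B\<close>.\<close>
  define P where "P = {..<m}"
  define X where "X = {m..<m + s}"
  define B where "B = {m + s..<2 * m + s + 1}"
  define A where "A = {2 * m + s + 1..<3 * m + 2}"
  define Q where "Q = {3 * m + 2..<4 * m + 2 - s}"
  define Y where "Y = {4 * m + 2 - s..<n}"
  note blocks = P_def X_def B_def A_def Q_def Y_def
  have disj: "x \<in> P \<Longrightarrow> x \<notin> X \<union> B \<union> A \<union> Q \<union> Y" "x \<in> X \<Longrightarrow> x \<notin> B \<union> A \<union> Q \<union> Y"
    "x \<in> B \<Longrightarrow> x \<notin> A \<union> Q \<union> Y" "x \<in> A \<Longrightarrow> x \<notin> Q \<union> Y" "x \<in> Q \<Longrightarrow> x \<notin> Y" for x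
    using \<open>s \<le> m\<close> by (auto simp: blocks)
  \<comment> \<open>Each pair of blocks is listed in one order only; \<open>c\<close>
    symmetrises.\<close>
  define red where "red x y \<longleftrightarrow>
      x \<in> P \<union> X \<and> y \<in> B \<and> \<not> H x (y - (m + s)) \<or>
      x \<in> A \<and> y \<in> X \<union> Q \<or> x \<in> X \<union> Q \<union> B \<and> y \<in> Y \<or> x \<in> B \<union> Q \<and> y \<in> B" for x y
  define c where "c e = (if \<exists>x y. e = {x, y} \<and> red x y then Red else Blue)" for e
  have c_Red: "c {x, y} = Red \<longleftrightarrow> red x y \<or> red y x" for x y
    by (auto simp: c_def doubleton_eq_iff)
  define N where "N u = {y \<in> B. \<not> H u (y - (m + s))}" for u
  have card_N: "card (N u) \<le> m + 1 - card {b. b \<le> m \<and> H u b}" for u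
  proof -
    have "N u \<subseteq> (+) (m + s) ` ({..m} - {b. b \<le> m \<and> H u b})"
    proof
      fix y assume "y \<in> N u"
      then have "y = (m + s) + (y - (m + s))" "y - (m + s) \<in> {..m} - {b. b \<le> m \<and> H u b}"
        by (auto simp: N_def B_def)
      then show "y \<in> (+) (m + s) ` ({..m} - {b. b \<le> m \<and> H u b})"
        by blast
    qed
    then have "card (N u) \<le> card ({..m} - {b. b \<le> m \<and> H u b})"
      by (rule surj_card_le[rotated]) simp
    also have "\<dots> = m + 1 - card {b. b \<le> m \<and> H u b}"
      by (subst card_Diff_subset) auto
    finally show ?thesis .
  qed
  have fin_N: "finite (N u)" for u
    by (simp add: N_def B_def)
  have "card W + 2 * m < n"
    if sub: "subgraph W F {..<n} (nsets {..<n} 2)" and mono: "monochromatic_edges c F"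
      and conn: "k_connected (Suc m) W F" for W F
  proof -
    have graph: "simple_graph W F" and W: "W \<subseteq> {..<n}"
      using sub by (auto simp: subgraph_def)
    have edge: "x \<in> W" "y \<in> W" if "{x, y} \<in> F" for x y
      using graph that by (auto simp: simple_graph_def nsets_def)
    have count: ?thesis if "R \<subseteq> {..<n}" "card R = 2 * m + 1" "W \<inter> R = {}" for R
    proof -
      have "card (W \<union> R) \<le> n"
        using W that(1) card_mono[of "{..<n}" "W \<union> R"] by simp
      moreover have "card (W \<union> R) = card W + card R"
        using W that by (intro card_Un_disjoint) (auto intro: finite_subset)
      ultimately show ?thesis
        using that(2) by simp
    qed
    obtain i where i: "\<And>e. e \<in> F \<Longrightarrow> c e = i"
      using mono by (auto simp: monochromatic_edges_def)
    show ?thesis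
    proof (cases i)
      case Red
      have red: "red x y \<or> red y x" if "{x, y} \<in> F" for x y
        using i[OF that] Red by (simp add: c_Red)
      have no_P: "x \<notin> W" if "x \<in> P" for x
      proof (rule k_connected_min_degree[OF conn graph, where S = "N x"])
        obtain b where "b \<le> m" "H x b"
          using H(3)[of x] \<open>x \<in> P\<close> by (auto simp: P_def)
        then have "card {b. b \<le> m \<and> H x b} > 0"
          by (auto simp: card_gt_0_iff)
        then show "card (N x) < Suc m"
          using card_N[of x] by linarith
        show "y \<in> N x" if "{x, y} \<in> F" for y
          using red[OF that] \<open>x \<in> P\<close> disj[of x] unfolding red_def N_def by blast
      qed (rule fin_N)
      have no_A: "x \<notin> W" if "x \<in> A" for x
      proof (rule k_connected_min_degree[OF conn graph, where S = "X \<union> Q"])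
        show "card (X \<union> Q) < Suc m"
          by (rule le_less_trans[OF card_Un_le]) (use \<open>s \<le> m\<close> in \<open>simp add: X_def Q_def\<close>)
        show "y \<in> X \<union> Q" if "{x, y} \<in> F" for y
          using red[OF that] \<open>x \<in> A\<close> disj[of x] unfolding red_def by blast
      qed (simp add: X_def Q_def)
      \<comment> \<open>With \<open>A\<close> gone, the red neighbours left are the m - s vertices
        of \<open>Y\<close> and at most s in \<open>B\<close>.\<close>
      have no_X: "x \<notin> W" if "x \<in> X" for x
      proof (rule k_connected_min_degree[OF conn graph, where S = "Y \<union> N x"])
        have "card (N x) \<le> s"
          using card_N[of x] H(4)[of x] that by (auto simp: X_def)
        moreover have "card Y = m - s"
          using assms by (simp add: Y_def)
        ultimately show "card (Y \<union> N x) < Suc m"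
          using card_Un_le[of Y "N x"] \<open>s \<le> m\<close> by linarith
        show "y \<in> Y \<union> N x" if "{x, y} \<in> F" for y
          using red[OF that] edge[OF that] no_A[of y] \<open>x \<in> X\<close> disj[of x]
          unfolding red_def N_def by blast
      qed (simp add: fin_N Y_def)
      have "card (P \<union> X \<union> A) = 2 * m + 1"
        using \<open>s \<le> m\<close> by (subst card_Un_disjoint; (subst card_Un_disjoint)?) (auto simp: blocks)
      moreover have "P \<union> X \<union> A \<subseteq> {..<n}"
        using assms by (auto simp: blocks)
      ultimately show ?thesis
        using no_P no_A no_X by (intro count[of "P \<union> X \<union> A"]) auto
    next
      case Blue
      have V: "x \<in> P \<union> X \<union> B \<union> A \<union> Q \<union> Y" if "x \<in> W" for x
        using W that by (auto simp: blocks)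
      have blue: "\<not> red x y" "\<not> red y x" if "{x, y} \<in> F" for x y
        using i[OF that] Blue c_Red[of x y] by auto
      \<comment> \<open>At most (m + 1 - s) + (s - 1) = m blue neighbours.\<close>
      have no_B: "x \<notin> W" if "x \<in> B" for x
      proof (rule k_connected_min_degree[OF conn graph, where S = "A \<union> {u. H u (x - (m + s))}"])
        have "card A = m + 1 - s"
          by (simp add: A_def)
        then show "card (A \<union> {u. H u (x - (m + s))}) < Suc m"
          using card_Un_le[of A "{u. H u (x - (m + s))}"] H(2)[of "x - (m + s)"] \<open>s \<le> m\<close>
          by linarith
        show "y \<in> A \<union> {u. H u (x - (m + s))}" if "{x, y} \<in> F" for y
          using blue[OF that] V[OF edge(2)[OF that]] \<open>x \<in> B\<close> by (auto simp: red_def)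
      qed (simp add: A_def H(1))
      \<comment> \<open>With \<open>B\<close> gone, blue edges leave \<open>X \<union> Q\<close>
        only towards \<open>P\<close>, which has m vertices.\<close>
      have "W \<inter> (X \<union> Q) \<subseteq> P \<or> W \<subseteq> (X \<union> Q) \<union> P"
      proof (rule k_connected_separation[OF conn graph])
        show "y \<in> (X \<union> Q) \<union> P" if "x \<in> X \<union> Q" "{x, y} \<in> F" for x y
          using blue[OF that(2)] V[OF edge(2)[OF that(2)]] edge(2)[OF that(2)] no_B[of y] that(1)
          by (auto simp: red_def)
      qed (auto simp: P_def)
      then show ?thesis
      proof
        assume "W \<inter> (X \<union> Q) \<subseteq> P"
        then have "W \<inter> (X \<union> Q \<union> B) = {}"
          using no_B by (auto simp: blocks)
        moreover have "card (X \<union> Q \<union> B) = 2 * m + 1"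
          using \<open>s \<le> m\<close> by (subst card_Un_disjoint; (subst card_Un_disjoint)?) (auto simp: blocks)
        moreover have "X \<union> Q \<union> B \<subseteq> {..<n}"
          using assms by (auto simp: blocks)
        ultimately show ?thesis
          by (intro count)
      next
        assume "W \<subseteq> (X \<union> Q) \<union> P"
        then have "card W \<le> card ((X \<union> Q) \<union> P)"
          by (intro card_mono) (auto simp: blocks)
        also have "\<dots> = 2 * m"
          using \<open>s \<le> m\<close> by (subst card_Un_disjoint; (subst card_Un_disjoint)?) (auto simp: blocks)
        finally show ?thesis
          \<comment> \<open>Here n > 4 m enters: |W| + 2 m \<le> 4 m.\<close>
          using assms by linarith
      qed
    qed
  qed
  then show ?thesis by blast
qed

theorem theorem1:
  fixes k n :: nat
  assumes "k > 0"
    and "int n = 5 * int k - 2 * \<lceil>sqrt (2 * real k - 1)\<rceil> - 3"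
  shows "\<exists>c :: nat set \<Rightarrow> colour.
    \<not> (\<exists>W F. subgraph W F {..<n} (nsets {..<n} 2) \<and> monochromatic_edges c F \<and>
          k_connected k W F \<and> int (card W) \<ge> int n - 2 * int k + 2)"
proof -
  obtain m where k: "k = Suc m"
    using assms(1) gr0_conv_Suc by blast
  define s where "s = nat \<lceil>sqrt (2 * real k - 1)\<rceil>"
  have "sqrt (2 * real k - 1) \<ge> 0"
    by (simp add: k)
  then have "\<lceil>sqrt (2 * real k - 1)\<rceil> \<ge> 0"
    by linarith
  then have s: "int s = \<lceil>sqrt (2 * real k - 1)\<rceil>"
    by (simp add: s_def)
  then have "sqrt (2 * real k - 1) \<le> real s"
    by linarith
  then have "2 * real k - 1 \<le> (real s)\<^sup>2"
    by (rule sqrt_le_D)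
  then have "real (2 * m + 1) \<le> real (s\<^sup>2)"
    by (simp add: k)
  then have square: "2 * m + 1 \<le> s\<^sup>2"
    by (simp only: of_nat_le_iff)
  have n: "int n = 5 * int m + 2 - 2 * int s"
    using assms(2) s k by simp
  show ?thesis
  \<comment> \<open>In the first case no monochromatic subgraph of any order is k-connected.\<close>
  proof (cases "n \<le> 4 * m")
    case True
    then show ?thesis
      using path_blowup_colouring[of n m] unfolding k by blast
  next
    case False
    then have "2 * s \<le> m + 1" "n = 5 * m + 2 - 2 * s"
      using n by linarith+
    then obtain c :: "nat set \<Rightarrow> colour" where c:
      "\<And>W F. subgraph W F {..<n} (nsets {..<n} 2) \<Longrightarrow> monochromatic_edges c F \<Longrightarrow>
        k_connected (Suc m) W F \<Longrightarrow> card W + 2 * m < n"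
      using six_block_colouring[of s m n] square by blast
    show ?thesis
    proof (intro exI[of _ c] notI, elim exE conjE)
      fix W F
      assume "subgraph W F {..<n} (nsets {..<n} 2)" "monochromatic_edges c F" "k_connected k W F"
        and "int (card W) \<ge> int n - 2 * int k + 2"
      then show False
        using c[of W F] by (simp add: k)
    qed
  qed
qed

end
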